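(* Let $N=\{1,\dots,n\}$ be the set of buyers and $M=\{1,\dots,m\}$ the set of goods, with $m<n$. Suppose there are linear functions $w_i,f_i:\mathbb R\to\mathbb R$ $(i\in N)$, with every $w_i$ strictly increasing, such that: (1) each buyer's valuation of a nonempty set of goods equals the valuation of the highest-valued good in the set: $v_{i,S}=\max_{K\in S}v_{i,K}$; (2) $v_{i,K}(s_{1K},\dots,s_{nK})=w_i(s_{iK})+\sum_{j\ne i}f_j(s_{jK})$ for all $i\in N$, $K\in M$ and all $(s_{1K},\dots,s_{nK})$; (3) $w_i'>f_i'$ for all $i\in N$; (4) all valuations are nonnegative at the buyers' true signals: $v_{i,K}(s_{1K},\dots,s_{nK})\ge 0$ for all $i\in N,K\in M$. Then truthful bidding (each buyer $i$ submits his or her true signal vector $(s_{i1},\dots,s_{im})$) is a Nash equilibrium of Auction 2 (defined in the context).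
   Context: "Linear" means of the form $x\mapsto ax+b$. Buyer $i$ privately observes one real signal $s_{iK}\in\mathcal S_{iK}\subseteq\mathbb R$ for each good $K$; $v_{i,K}$ is a function of $s_K=(s_{1K},\dots,s_{nK})$. The valuation functions are common knowledge and known to the auction designer. A buyer who receives a set $S$ of goods (with $v_{i,\emptyset}=0$) and pays $P$ has utility $v_{i,S}-P$ (valuation evaluated at the true signals); with random tie-breaking, utilities are expected utilities. The welfare of an allocation is the sum over buyers of their valuations of the sets they receive. Auction 2: (Bidding) Each buyer $i$ submits a vector $(s_{i1},\dots,s_{im})\in\mathbb R^m$. In the rules below, all valuations are computed from the submitted vectors, as if they were the true signals; $s_A=(s_{1A},\dots,s_{nA})$. (Allocation) Among the allocations of all goods of $M$ to the buyers in $N$ in which each buyer receives at most one good, select one that maximizes welfare (uniformly at random among the maximizers if there are several). Denote by $i_A$ the buyer who receives good $A$. (Payment) A buyer who receives no good pays nothing. If buyer $i$ receives good $K$ (so $i_K=i$), consider a welfare-maximizing allocation, selected by the same rules, of the goods of $M$ to the buyers in $N\setminus\{i\}$, each buyer receiving at most one good; let $j_A\neq i$ be the buyer receiving good $A$ in it. Buyer $i$ pays $$v_{i,K}(s_{1K},\dots,s_{(i-1)K},s_{iK}^*,s_{(i+1)K},\dots,s_{nK}),$$ where $s_{iK}^*\in\mathbb R$ solves $$v_{i,K}(s_{1K},\dots,s_{iK}^*,\dots,s_{nK})+\sum_{A\in M,A\ne K}v_{i_A,A}(s_A)=v_{j_K,K}(s_{1K},\dots,s_{iK}^*,\dots,s_{nK})+\sum_{A\in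 M,A\neq K}v_{j_A,A}(s_A).$$ Nash equilibrium (of pure strategies, a strategy mapping a buyer's own signals to a bid): at every profile of true signals satisfying the hypotheses, for every buyer $i$, if all other buyers follow their prescribed strategies, then no bid of buyer $i$ gives buyer $i$ a strictly higher utility than the prescribed one. *)

theory Defs
  imports "HOL-Probability.Probability"
begin

text \<open>
  \<open>N\<close> is the set of buyers and \<open>M\<close> the set of goods. A profile \<open>s\<close> (of true or of submitted signals)
  maps a buyer \<open>i\<close> and a good \<open>K\<close> to the signal \<open>s i K\<close>.
  \<open>v i K x\<close> is the valuation of good \<open>K\<close> by buyer \<open>i\<close> at the signals \<open>x\<close> of the buyers for \<open>K\<close>;
  \<open>V i S s\<close> is the valuation of the set \<open>S\<close> of goods at the signal profile \<open>s\<close>.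
\<close>

type_synonym ('i, 'g) profile = "'i \<Rightarrow> 'g \<Rightarrow> real"
type_synonym ('i, 'g) valuation = "'i \<Rightarrow> 'g \<Rightarrow> ('i \<Rightarrow> real) \<Rightarrow> real"
type_synonym ('i, 'g) set_valuation = "'i \<Rightarrow> 'g set \<Rightarrow> ('i, 'g) profile \<Rightarrow> real"

definition linear_fun :: "(real \<Rightarrow> real) \<Rightarrow> bool" where
  "linear_fun g \<longleftrightarrow> (\<exists>a b. \<forall>x. g x = a * x + b)"

definition signals_for :: "('i, 'g) profile \<Rightarrow> 'g \<Rightarrow> 'i \<Rightarrow> real" where
  "signals_for s K = (\<lambda>j. s j K)"

text \<open>An allocation \<open>\<alpha>\<close> maps each good to the buyer who receives it. All goods are allocated, and by
  injectivity each buyer receives at most one good.\<close>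

definition allocations :: "'i set \<Rightarrow> 'g set \<Rightarrow> ('g \<Rightarrow> 'i) set" where
  "allocations N M = {\<alpha> \<in> M \<rightarrow>\<^sub>E N. inj_on \<alpha> M}"

definition received :: "'g set \<Rightarrow> ('g \<Rightarrow> 'i) \<Rightarrow> 'i \<Rightarrow> 'g set" where
  "received M \<alpha> i = {K \<in> M. \<alpha> K = i}"

definition welfare ::
  "'i set \<Rightarrow> 'g set \<Rightarrow> ('i, 'g) set_valuation \<Rightarrow> ('i, 'g) profile \<Rightarrow> ('g \<Rightarrow> 'i) \<Rightarrow> real" where
  "welfare N M V s \<alpha> = (\<Sum>i\<in>N. V i (received M \<alpha> i) s)"

definition optimal_allocations ::
  "'i set \<Rightarrow> 'g set \<Rightarrow> ('i, 'g) set_valuation \<Rightarrow> ('i, 'g) profile \<Rightarrow> ('g \<Rightarrow> 'i) set" where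
  "optimal_allocations N M V s =
     {\<alpha> \<in> allocations N M. \<forall>\<beta> \<in> allocations N M. welfare N M V s \<beta> \<le> welfare N M V s \<alpha>}"

definition selected_allocation ::
  "'i set \<Rightarrow> 'g set \<Rightarrow> ('i, 'g) set_valuation \<Rightarrow> ('i, 'g) profile \<Rightarrow> ('g \<Rightarrow> 'i) pmf" where
  "selected_allocation N M V s = pmf_of_set (optimal_allocations N M V s)"

text \<open>The equation for the critical signal \<open>x\<close> of buyer \<open>i\<close> for good \<open>K\<close>, at submitted signals \<open>b\<close>,
  where \<open>\<alpha>\<close> allocates the goods to all buyers and \<open>\<beta>\<close> to the buyers other than \<open>i\<close>.\<close>

definition solves_critical ::
  "'g set \<Rightarrow> ('i, 'g) valuation \<Rightarrow> ('i, 'g) profile \<Rightarrow> ('g \<Rightarrow> 'i) \<Rightarrow> ('g \<Rightarrow> 'i) \<Rightarrow> 'i \<Rightarrow> 'g \<Rightarrow> real \<Rightarrow> bool"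
where
  "solves_critical M v b \<alpha> \<beta> i K x \<longleftrightarrow>
     v i K ((signals_for b K)(i := x)) + (\<Sum>A\<in>M - {K}. v (\<alpha> A) A (signals_for b A))
     = v (\<beta> K) K ((signals_for b K)(i := x)) + (\<Sum>A\<in>M - {K}. v (\<beta> A) A (signals_for b A))"

text \<open>For linear valuations \<open>w\<^sub>i(s\<^sub>i\<^sub>K) + \<Sum>\<^sub>j f\<^sub>j(s\<^sub>j\<^sub>K)\<close> with \<open>w\<^sub>i' > f\<^sub>i'\<close> the critical signal is
  unique, so the choice made by \<open>SOME\<close> is immaterial; \<open>received M \<alpha> i\<close> is empty or a singleton.\<close>

definition payment ::
  "'g set \<Rightarrow> ('i, 'g) valuation \<Rightarrow> ('i, 'g) profile \<Rightarrow> ('g \<Rightarrow> 'i) \<Rightarrow> ('g \<Rightarrow> 'i) \<Rightarrow> 'i \<Rightarrow> real" where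
  "payment M v b \<alpha> \<beta> i =
     (if received M \<alpha> i = {} then 0
      else let K = the_elem (received M \<alpha> i)
           in v i K ((signals_for b K)(i := (SOME x. solves_critical M v b \<alpha> \<beta> i K x))))"

text \<open>Expected utility of buyer \<open>i\<close> when the true signals are \<open>s\<close> and the submitted ones \<open>b\<close>. The
  allocation \<open>\<alpha>\<close> and the allocation \<open>\<beta>\<close> to the buyers other than \<open>i\<close> are drawn independently.\<close>

definition auction2_utility ::
  "'i set \<Rightarrow> 'g set \<Rightarrow> ('i, 'g) valuation \<Rightarrow> ('i, 'g) set_valuation \<Rightarrow>
   ('i, 'g) profile \<Rightarrow> ('i, 'g) profile \<Rightarrow> 'i \<Rightarrow> real" where
  "auction2_utility N M v V s b i =
     measure_pmf.expectation
       (pair_pmf (selected_allocation N M V b) (selected_allocation (N - {i}) M V b))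
       (\<lambda>(\<alpha>, \<beta>). V i (received M \<alpha> i) s - payment M v b \<alpha> \<beta> i)"

text \<open>\<open>T\<close> is the set of admissible profiles of true signals, \<open>U s b i\<close> the utility of buyer \<open>i\<close> at true
  signals \<open>s\<close> and bids \<open>b\<close>, and \<open>\<sigma> i\<close> maps the own signals of buyer \<open>i\<close> to a bid.\<close>

definition nash_equilibrium ::
  "'i set \<Rightarrow> ('i, 'g) profile set \<Rightarrow> (('i, 'g) profile \<Rightarrow> ('i, 'g) profile \<Rightarrow> 'i \<Rightarrow> real) \<Rightarrow>
   ('i \<Rightarrow> ('g \<Rightarrow> real) \<Rightarrow> 'g \<Rightarrow> real) \<Rightarrow> bool" where
  "nash_equilibrium N T U \<sigma> \<longleftrightarrow>
     (\<forall>s\<in>T. \<forall>i\<in>N. \<forall>bid. U s ((\<lambda>j. \<sigma> j (s j))(i := bid)) i \<le> U s (\<lambda>j. \<sigma> j (s j)) i)"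

definition truthful :: "'i \<Rightarrow> ('g \<Rightarrow> real) \<Rightarrow> 'g \<Rightarrow> real" where
  "truthful i t = t"

end

theory Submission
  imports Defs
begin

text \<open>Put \<open>h j = w j - f j\<close>, a strictly increasing linear function. For every buyer \<open>j\<close> the value of
  good \<open>K\<close> is \<open>h j (s j K) + F K\<close> with \<open>F K = (\<Sum>k\<in>N. f k (s k K))\<close> not depending on \<open>j\<close>. As all goods are
  always allocated, maximizing welfare is maximizing the sum of the private scores \<open>h j (s j K)\<close>, and in
  the equation for the critical signal \<open>x\<close> all the terms \<open>F\<close> cancel: \<open>h i x\<close> is the price of the
  Vickrey-Clarke-Groves mechanism for the scores. Since \<open>w i\<close> is linear, differences of \<open>w i\<close> are
  a positive constant times differences of \<open>h i\<close>. The utility of buyer \<open>i\<close> is thus that constant times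
  the true total score of the selected allocation minus the best total score without \<open>i\<close>, and
  truthful bidding makes the auction maximize exactly this quantity.\<close>

section \<open>Linear functions, allocations and finite distributions\<close>

lemma linear_fun_deriv:
  assumes "linear_fun g"
  shows "g x = deriv g 0 * x + g 0"
proof -
  obtain a b where g: "g = (\<lambda>x. a * x + b)"
    using assms unfolding linear_fun_def by auto
  \<comment> \<open>Slopes are compared through \<open>deriv\<close> in the hypotheses, so
    \<open>a\<close> must be identified with a derivative; as it is constant, the point 0
    serves.\<close>
  have "(g has_real_derivative a) (at 0)"
    unfolding g by (auto intro!: derivative_eq_intros)
  then show ?thesis
    using DERIV_imp_deriv by (auto simp: g)
qed

lemma received_inj:
  assumes "inj_on \<alpha> M" "K \<in> M"
  shows "received M \<alpha> (\<alpha> K) = {K}"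
  using assms by (auto simp: received_def dest: inj_onD)

lemma allocations_mono: "N' \<subseteq> N \<Longrightarrow> allocations N' M \<subseteq> allocations N M"
  unfolding allocations_def by (auto simp: PiE_iff)

lemma allocations_Diff:
  assumes "\<alpha> \<in> allocations N M" "received M \<alpha> i = {}"
  shows "\<alpha> \<in> allocations (N - {i}) M"
  using assms unfolding allocations_def received_def by (auto simp: PiE_iff)

lemma finite_allocations:
  assumes "finite N" "finite M"
  shows "finite (allocations N M)"
proof (rule finite_subset)
  show "allocations N M \<subseteq> M \<rightarrow>\<^sub>E N"
    by (auto simp: allocations_def)
qed (simp add: assms finite_PiE)

lemma allocations_nonempty:
  assumes "finite N" "finite M" "card M \<le> card N"
  shows "allocations N M \<noteq> {}"
proof -
  obtain g where "g ` M \<subseteq> N" "inj_on g M"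
    using card_le_inj[OF assms(2,1,3)] by blast
  then have "restrict g M \<in> allocations N M"
    by (auto simp: allocations_def inj_on_def)
  then show ?thesis
    by blast
qed

text \<open>\<open>pmf_of_set\<close> is meaningful only on a finite nonempty set. Enough buyers
  give finitely many but at least one allocation, so the maximal welfare is attained.\<close>

lemma set_pmf_selected_allocation:
  assumes "finite N" "finite M" "card M \<le> card N"
  shows "set_pmf (selected_allocation N M V s) = optimal_allocations N M V s"
    and "finite (optimal_allocations N M V s)"
    and "optimal_allocations N M V s \<noteq> {}"
proof -
  note A = finite_allocations[OF assms(1,2)] allocations_nonempty[OF assms]
  show fin: "finite (optimal_allocations N M V s)"
    using A(1) by (simp add: optimal_allocations_def)
  have "Max (welfare N M V s ` allocations N M) \<in> welfare N M V s ` allocations N M"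
    using A by (intro Max_in) auto
  then obtain \<alpha> where "\<alpha> \<in> allocations N M"
      "welfare N M V s \<alpha> = Max (welfare N M V s ` allocations N M)"
    by auto
  then have "\<alpha> \<in> optimal_allocations N M V s"
    using A by (simp add: optimal_allocations_def)
  then show ne: "optimal_allocations N M V s \<noteq> {}"
    by blast
  show "set_pmf (selected_allocation N M V s) = optimal_allocations N M V s"
    unfolding selected_allocation_def using ne fin by simp
qed

text \<open>Finite support makes \<open>g\<close> integrable. Otherwise the expectation could take
  the default value 0 and violate a negative bound.\<close>

lemma pmf_expectation_le_const:
  fixes g :: "'a \<Rightarrow> real"
  assumes "finite (set_pmf p)" "\<And>x. x \<in> set_pmf p \<Longrightarrow> g x \<le> c"
  shows "measure_pmf.expectation p g \<le> c"
proof -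
  have "measure_pmf.expectation p g \<le> measure_pmf.expectation p (\<lambda>_. c)"
    using assms by (intro integral_mono_AE) (auto intro: integrable_measure_pmf_finite simp: AE_measure_pmf_iff)
  then show ?thesis
    by simp
qed

lemma pmf_expectation_eq_const:
  fixes g :: "'a \<Rightarrow> real"
  assumes "\<And>x. x \<in> set_pmf p \<Longrightarrow> g x = c"
  shows "measure_pmf.expectation p g = c"
proof -
  have "measure_pmf.expectation p g = measure_pmf.expectation p (\<lambda>_. c)"
    using assms by (intro integral_cong_AE) (auto simp: AE_measure_pmf_iff)
  then show ?thesis
    by simp
qed

section \<open>Scores and valuations in a linear auction\<close>

locale linear_auction =
  fixes N :: "'i set" and M :: "'g set"
    and v :: "('i, 'g) valuation" and V :: "('i, 'g) set_valuation"
    and w f :: "'i \<Rightarrow> real \<Rightarrow> real"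
  assumes finite_N: "finite N" and finite_M: "finite M" and card_less: "card M < card N"
    and w_linear: "\<And>i. i \<in> N \<Longrightarrow> linear_fun (w i)"
    and f_linear: "\<And>i. i \<in> N \<Longrightarrow> linear_fun (f i)"
    and w_mono: "\<And>i. i \<in> N \<Longrightarrow> strict_mono (w i)"
    and V_empty: "\<And>i s. i \<in> N \<Longrightarrow> V i {} s = 0"
    and V_singleton: "\<And>i K s. i \<in> N \<Longrightarrow> K \<in> M \<Longrightarrow> V i {K} s = v i K (signals_for s K)"
    and v_eq: "\<And>i K x. i \<in> N \<Longrightarrow> K \<in> M \<Longrightarrow> v i K x = w i (x i) + (\<Sum>j\<in>N - {i}. f j (x j))"
    and deriv_less: "\<And>i x. i \<in> N \<Longrightarrow> deriv (f i) x < deriv (w i) x"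
begin

text \<open>This is \<open>h j\<close> of the overview; \<open>common\<close> below, at the signals
  for \<open>K\<close>, is \<open>F K\<close>.\<close>

definition score :: "'i \<Rightarrow> real \<Rightarrow> real" where
  "score j x = w j x - f j x"

definition total_score :: "('i, 'g) profile \<Rightarrow> ('g \<Rightarrow> 'i) \<Rightarrow> real" where
  "total_score s \<alpha> = (\<Sum>A\<in>M. score (\<alpha> A) (s (\<alpha> A) A))"

definition common :: "('i \<Rightarrow> real) \<Rightarrow> real" where
  "common x = (\<Sum>j\<in>N. f j (x j))"

text \<open>The ratio \<open>w i' / h i'\<close> of two constant slopes, taken at 0: it converts
  score differences of buyer \<open>i\<close> into money.\<close>

definition slope_ratio :: "'i \<Rightarrow> real" where
  "slope_ratio i = deriv (w i) 0 / (deriv (w i) 0 - deriv (f i) 0)"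

lemma score_linear:
  assumes "i \<in> N"
  shows "score i x = (deriv (w i) 0 - deriv (f i) 0) * x + (w i 0 - f i 0)"
  unfolding score_def
  using linear_fun_deriv[OF w_linear[OF assms], of x] linear_fun_deriv[OF f_linear[OF assms], of x]
  by (simp add: algebra_simps)

text \<open>Monotonicity of \<open>w i\<close> makes the numerator positive,
  \<open>deriv_less\<close> the denominator. The sign is what lets a larger total score mean a
  larger utility.\<close>

lemma slope_ratio_pos:
  assumes "i \<in> N"
  shows "slope_ratio i > 0"
proof -
  have "w i 0 < w i 1"
    using w_mono[OF assms] by (simp add: strict_mono_def)
  then have "deriv (w i) 0 > 0"
    using linear_fun_deriv[OF w_linear[OF assms], of 1] by simp
  then show ?thesis
    using deriv_less[OF assms, of 0] by (simp add: slope_ratio_def)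
qed

lemma w_diff:
  assumes "i \<in> N"
  shows "w i x - w i y = slope_ratio i * (score i x - score i y)"
proof -
  have "score i x - score i y = (deriv (w i) 0 - deriv (f i) 0) * (x - y)"
    unfolding score_linear[OF assms] by (simp add: algebra_simps)
  moreover have "w i x - w i y = deriv (w i) 0 * (x - y)"
    using linear_fun_deriv[OF w_linear[OF assms], of x] linear_fun_deriv[OF w_linear[OF assms], of y]
    by (simp add: algebra_simps)
  ultimately show ?thesis
    using deriv_less[OF assms, of 0] by (simp add: slope_ratio_def)
qed

text \<open>A nonconstant linear function is onto; this guarantees that a critical signal
  exists.\<close>

lemma score_surj:
  assumes "i \<in> N"
  shows "\<exists>x. score i x = y"
proof
  show "score i ((y - (w i 0 - f i 0)) / (deriv (w i) 0 - deriv (f i) 0)) = y"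
    unfolding score_linear[OF assms] using deriv_less[OF assms, of 0] by simp
qed

lemma v_eq_score:
  assumes "i \<in> N" "K \<in> M"
  shows "v i K x = score i (x i) + common x"
  using v_eq[OF assms, of x] sum.remove[OF finite_N assms(1), of "\<lambda>j. f j (x j)"]
  by (simp add: score_def common_def)

section \<open>Welfare as total score\<close>

lemma sum_v_eq:
  assumes "\<alpha> \<in> allocations N M" "B \<subseteq> M"
  shows "(\<Sum>A\<in>B. v (\<alpha> A) A (signals_for s A)) =
    (\<Sum>A\<in>B. score (\<alpha> A) (s (\<alpha> A) A)) + (\<Sum>A\<in>B. common (signals_for s A))"
proof -
  have "v (\<alpha> A) A (signals_for s A) = score (\<alpha> A) (s (\<alpha> A) A) + common (signals_for s A)"
    if "A \<in> B" for A
    using assms that by (subst v_eq_score) (auto simp: allocations_def signals_for_def)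
  then show ?thesis
    by (simp add: sum.distrib)
qed

text \<open>Every good is allocated, so the common terms add up to a constant independent of
  \<alpha>. The subset \<open>N'\<close> covers the auction without one buyer, while
  \<open>common\<close> still sums over all of \<open>N\<close>.\<close>

lemma welfare_eq:
  assumes N': "N' \<subseteq> N" and \<alpha>: "\<alpha> \<in> allocations N' M"
  shows "welfare N' M V s \<alpha> = total_score s \<alpha> + (\<Sum>A\<in>M. common (signals_for s A))"
proof -
  have inj: "inj_on \<alpha> M" and ran: "\<alpha> ` M \<subseteq> N'"
    using \<alpha> by (auto simp: allocations_def)
  \<comment> \<open>Buyers outside the image receive the empty set, of value 0; injectivity then
    turns the sum over winners into a sum over goods.\<close>
  have "welfare N' M V s \<alpha> = (\<Sum>i\<in>\<alpha> ` M. V i (received M \<alpha> i) s)"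
    unfolding welfare_def
  proof (rule sum.mono_neutral_right)
    show "finite N'"
      using N' finite_N by (rule finite_subset)
    show "\<forall>i\<in>N' - \<alpha> ` M. V i (received M \<alpha> i) s = 0"
    proof
      fix i assume i: "i \<in> N' - \<alpha> ` M"
      then have "received M \<alpha> i = {}"
        by (auto simp: received_def)
      then show "V i (received M \<alpha> i) s = 0"
        using i N' V_empty by auto
    qed
  qed (rule ran)
  also have "\<dots> = (\<Sum>A\<in>M. V (\<alpha> A) (received M \<alpha> (\<alpha> A)) s)"
    by (simp add: sum.reindex[OF inj])
  also have "\<dots> = (\<Sum>A\<in>M. v (\<alpha> A) A (signals_for s A))"
  proof (rule sum.cong)
    fix A assume A: "A \<in> M"
    then have "\<alpha> A \<in> N"
      using ran N' by auto
    then show "V (\<alpha> A) (received M \<alpha> (\<alpha> A)) s = v (\<alpha> A) A (signals_for s A)"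
      using A by (simp add: received_inj[OF inj] V_singleton)
  qed simp
  also have "\<dots> = total_score s \<alpha> + (\<Sum>A\<in>M. common (signals_for s A))"
    unfolding total_score_def
    using \<alpha> allocations_mono[OF N'] by (intro sum_v_eq) auto
  finally show ?thesis .
qed

lemma optimal_allocations_eq:
  assumes "N' \<subseteq> N"
  shows "optimal_allocations N' M V s =
    {\<alpha> \<in> allocations N' M. \<forall>\<beta>\<in>allocations N' M. total_score s \<beta> \<le> total_score s \<alpha>}"
  unfolding optimal_allocations_def using welfare_eq[OF assms] by auto

section \<open>Unilateral deviations, critical signals and ex post utility\<close>

lemma total_score_cong:
  assumes "\<And>j. j \<noteq> i \<Longrightarrow> b j = s j" "\<alpha> \<in> allocations (N - {i}) M"
  shows "total_score b \<alpha> = total_score s \<alpha>"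
  unfolding total_score_def
proof (rule sum.cong)
  fix A assume "A \<in> M"
  then have "\<alpha> A \<noteq> i"
    using assms(2) by (auto simp: allocations_def)
  then show "score (\<alpha> A) (b (\<alpha> A) A) = score (\<alpha> A) (s (\<alpha> A) A)"
    by (simp add: assms(1))
qed simp

lemma optimal_allocations_cong:
  assumes "\<And>j. j \<noteq> i \<Longrightarrow> b j = s j"
  shows "optimal_allocations (N - {i}) M V b = optimal_allocations (N - {i}) M V s"
  using total_score_cong[OF assms] by (auto simp: optimal_allocations_eq)

text \<open>The common terms agree on both sides, also for \<open>K\<close>, where both use the
  modified signals. The bid of \<open>i\<close> is replaced by \<open>x\<close> at \<open>K\<close>
  and occurs in no other score, so only true signals remain; adding \<open>score i (s i K)\<close>
  completes the true total score of \<alpha>, whatever \<open>i\<close> bids.\<close>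

lemma solves_critical_iff:
  assumes i: "i \<in> N" and K: "K \<in> M" "\<alpha> K = i" and b: "\<And>j. j \<noteq> i \<Longrightarrow> b j = s j"
    and \<alpha>: "\<alpha> \<in> allocations N M" and \<beta>: "\<beta> \<in> allocations (N - {i}) M"
  shows "solves_critical M v b \<alpha> \<beta> i K x \<longleftrightarrow>
    score i (s i K) - score i x = total_score s \<alpha> - total_score s \<beta>"
proof -
  have \<beta>N: "\<beta> \<in> allocations N M"
    using \<beta> allocations_mono[of "N - {i}" N] by auto
  have \<beta>K: "\<beta> K \<in> N" "\<beta> K \<noteq> i"
    using \<beta> K by (auto simp: allocations_def)
  have "\<alpha> A \<noteq> i" if "A \<in> M - {K}" for A
    using \<alpha> K that by (auto simp: allocations_def dest: inj_onD)
  then have sum_\<alpha>: "(\<Sum>A\<in>M - {K}. score (\<alpha> A) (b (\<alpha> A) A))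
      = (\<Sum>A\<in>M - {K}. score (\<alpha> A) (s (\<alpha> A) A))"
    by (simp add: b)
  have "\<beta> A \<noteq> i" if "A \<in> M - {K}" for A
    using \<beta> that by (auto simp: allocations_def)
  then have sum_\<beta>: "(\<Sum>A\<in>M - {K}. score (\<beta> A) (b (\<beta> A) A))
      = (\<Sum>A\<in>M - {K}. score (\<beta> A) (s (\<beta> A) A))"
    by (simp add: b)
  have "total_score s \<gamma> =
      score (\<gamma> K) (s (\<gamma> K) K) + (\<Sum>A\<in>M - {K}. score (\<gamma> A) (s (\<gamma> A) A))" for \<gamma>
    unfolding total_score_def by (rule sum.remove[OF finite_M K(1)])
  then show ?thesis
    unfolding solves_critical_def sum_v_eq[OF \<alpha> Diff_subset] sum_v_eq[OF \<beta>N Diff_subset]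
      v_eq_score[OF i K(1)] v_eq_score[OF \<beta>K(1) K(1)] sum_\<alpha> sum_\<beta>
    using \<beta>K(2) K(2) by (auto simp: signals_for_def b)
qed

lemma ex_post_utility:
  assumes i: "i \<in> N" and b: "\<And>j. j \<noteq> i \<Longrightarrow> b j = s j"
    and \<alpha>: "\<alpha> \<in> optimal_allocations N M V b" and \<beta>: "\<beta> \<in> optimal_allocations (N - {i}) M V b"
  shows "V i (received M \<alpha> i) s - payment M v b \<alpha> \<beta> i =
    slope_ratio i * (total_score s \<alpha> - total_score s \<beta>)"
proof (cases "received M \<alpha> i = {}")
  case True
  have \<beta>': "\<beta> \<in> allocations (N - {i}) M" and \<alpha>': "\<alpha> \<in> allocations (N - {i}) M"
    using \<alpha> \<beta> allocations_Diff[OF _ True] by (auto simp: optimal_allocations_def)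
  \<comment> \<open>A loser's absence costs nothing: \<alpha> is feasible without \<open>i\<close>,
    and \<beta> is feasible with \<open>i\<close>.\<close>
  have "total_score b \<alpha> = total_score b \<beta>"
  proof (rule antisym)
    show "total_score b \<alpha> \<le> total_score b \<beta>"
      using \<beta> \<alpha>' by (auto simp: optimal_allocations_eq)
    show "total_score b \<beta> \<le> total_score b \<alpha>"
      using \<alpha> \<beta>' allocations_mono[of "N - {i}" N M] by (auto simp: optimal_allocations_eq)
  qed
  then have "total_score s \<alpha> = total_score s \<beta>"
    using total_score_cong[OF b \<alpha>'] total_score_cong[OF b \<beta>'] by simp
  then show ?thesis
    using True i by (simp add: payment_def V_empty)
next
  case False
  then obtain K where K: "K \<in> M" "\<alpha> K = i"
    by (auto simp: received_def)
  have \<alpha>': "\<alpha> \<in> allocations N M" and \<beta>': "\<beta> \<in> allocations (N - {i}) M"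
    using \<alpha> \<beta> by (auto simp: optimal_allocations_def)
  have rec: "received M \<alpha> i = {K}"
    using received_inj[of \<alpha> M K] \<alpha>' K by (auto simp: allocations_def)
  define x where "x = (SOME x. solves_critical M v b \<alpha> \<beta> i K x)"
  note critical = solves_critical_iff[OF i K b \<alpha>' \<beta>']
  \<comment> \<open>Some solution is needed before the one chosen by \<open>SOME\<close> is known to
    satisfy the equation.\<close>
  obtain y where "score i y = score i (s i K) - (total_score s \<alpha> - total_score s \<beta>)"
    using score_surj[OF i] by blast
  then have "solves_critical M v b \<alpha> \<beta> i K y"
    by (simp add: critical)
  then have "solves_critical M v b \<alpha> \<beta> i K x"
    unfolding x_def by (rule someI)
  then have x: "score i (s i K) - score i x = total_score s \<alpha> - total_score s \<beta>"
    by (simp add: critical)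
  have "V i (received M \<alpha> i) s - payment M v b \<alpha> \<beta> i
      = v i K (signals_for s K) - v i K ((signals_for b K)(i := x))"
    using K i by (simp add: rec payment_def x_def V_singleton)
  \<comment> \<open>The two signal vectors differ only at \<open>i\<close>, so the \<open>f\<close>
    terms of the other buyers cancel.\<close>
  also have "\<dots> = w i (s i K) - w i x"
    using b by (simp add: v_eq[OF i K(1)] signals_for_def)
  also have "\<dots> = slope_ratio i * (total_score s \<alpha> - total_score s \<beta>)"
    by (simp add: w_diff[OF i] x)
  finally show ?thesis .
qed

section \<open>Expected utility and equilibrium\<close>

lemma truthful_optimal:
  assumes i: "i \<in> N" and b: "\<And>j. j \<noteq> i \<Longrightarrow> b j = s j"
  shows "auction2_utility N M v V s b i \<le> auction2_utility N M v V s s i"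
proof -
  \<comment> \<open>The strict inequality between goods and buyers leaves enough buyers after one is
    removed.\<close>
  have card': "card M \<le> card (N - {i})"
    using card_less finite_N i by simp
  note opt = set_pmf_selected_allocation[OF finite_N finite_M less_imp_le[OF card_less], where V = V]
  note opt' = set_pmf_selected_allocation[OF finite_Diff[OF finite_N] finite_M card', where V = V]
  obtain \<alpha>0 where \<alpha>0: "\<alpha>0 \<in> optimal_allocations N M V s"
    using opt(3) by blast
  obtain \<beta>0 where \<beta>0: "\<beta>0 \<in> optimal_allocations (N - {i}) M V s"
    using opt'(3) by blast
  \<comment> \<open>The utility in every truthful outcome: ties change neither of the two maximal
    scores.\<close>
  define c where "c = slope_ratio i * (total_score s \<alpha>0 - total_score s \<beta>0)"
  have \<beta>_score: "total_score s \<beta> = total_score s \<beta>0"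
    if "\<beta> \<in> optimal_allocations (N - {i}) M V s" for \<beta>
    using that \<beta>0 by (force simp: optimal_allocations_eq intro: antisym)
  have "auction2_utility N M v V s b i \<le> c"
    unfolding auction2_utility_def
  proof (rule pmf_expectation_le_const)
    show "finite (set_pmf (pair_pmf (selected_allocation N M V b) (selected_allocation (N - {i}) M V b)))"
      by (simp add: opt opt')
    fix p
    assume "p \<in> set_pmf (pair_pmf (selected_allocation N M V b) (selected_allocation (N - {i}) M V b))"
    then obtain \<alpha> \<beta> where p: "p = (\<alpha>, \<beta>)" and \<alpha>: "\<alpha> \<in> optimal_allocations N M V b"
      and \<beta>: "\<beta> \<in> optimal_allocations (N - {i}) M V b"
      by (auto simp: opt opt')
    \<comment> \<open>Optimal for the bids, \<alpha> is merely feasible for the true signals, which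
      \<alpha>0 maximizes.\<close>
    have "total_score s \<alpha> \<le> total_score s \<alpha>0"
      using \<alpha> \<alpha>0 by (auto simp: optimal_allocations_eq)
    \<comment> \<open>The bid of \<open>i\<close> cannot influence the auction without
      \<open>i\<close>.\<close>
    moreover have "total_score s \<beta> = total_score s \<beta>0"
      using \<beta> optimal_allocations_cong[OF b] by (intro \<beta>_score) auto
    ultimately show "(case p of (\<alpha>, \<beta>) \<Rightarrow> V i (received M \<alpha> i) s - payment M v b \<alpha> \<beta> i) \<le> c"
      using slope_ratio_pos[OF i] by (simp add: p ex_post_utility[OF i b \<alpha> \<beta>] c_def)
  qed
  also have "c = auction2_utility N M v V s s i"
    unfolding auction2_utility_def
  proof (rule pmf_expectation_eq_const[symmetric])
    fix p
    assume "p \<in> set_pmf (pair_pmf (selected_allocation N M V s) (selected_allocation (N - {i}) M V s))"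
    then obtain \<alpha> \<beta> where p: "p = (\<alpha>, \<beta>)" and \<alpha>: "\<alpha> \<in> optimal_allocations N M V s"
      and \<beta>: "\<beta> \<in> optimal_allocations (N - {i}) M V s"
      by (auto simp: opt opt')
    have "total_score s \<alpha> = total_score s \<alpha>0"
      using \<alpha> \<alpha>0 by (force simp: optimal_allocations_eq intro: antisym)
    then show "(case p of (\<alpha>, \<beta>) \<Rightarrow> V i (received M \<alpha> i) s - payment M v s \<alpha> \<beta> i) = c"
      by (simp add: p ex_post_utility[OF i refl \<alpha> \<beta>] c_def \<beta>_score[OF \<beta>])
  qed
  finally show ?thesis .
qed

end

theorem theorem4p9:
  fixes n m :: nat
    and \<S> :: "nat \<Rightarrow> nat \<Rightarrow> real set"
    and v :: "(nat, nat) valuation"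
    and V :: "(nat, nat) set_valuation"
    and w f :: "nat \<Rightarrow> real \<Rightarrow> real"
  defines "N \<equiv> {1..n}" and "M \<equiv> {1..m}"
  assumes "m < n"
    and w_linear: "\<And>i. i \<in> N \<Longrightarrow> linear_fun (w i)"
    and f_linear: "\<And>i. i \<in> N \<Longrightarrow> linear_fun (f i)"
    and w_mono: "\<And>i. i \<in> N \<Longrightarrow> strict_mono (w i)"
    and V_empty: "\<And>i s. i \<in> N \<Longrightarrow> V i {} s = 0"
    and V_Max: "\<And>i S s. i \<in> N \<Longrightarrow> S \<subseteq> M \<Longrightarrow> S \<noteq> {} \<Longrightarrow>
                  V i S s = Max ((\<lambda>K. v i K (signals_for s K)) ` S)"
    and v_eq: "\<And>i K x. i \<in> N \<Longrightarrow> K \<in> M \<Longrightarrow>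
                  v i K x = w i (x i) + (\<Sum>j\<in>N - {i}. f j (x j))"
    and deriv_less: "\<And>i x. i \<in> N \<Longrightarrow> deriv (w i) x > deriv (f i) x"
  shows "nash_equilibrium N
           {s. \<forall>i\<in>N. \<forall>K\<in>M. s i K \<in> \<S> i K \<and> v i K (signals_for s K) \<ge> 0}
           (auction2_utility N M v V) truthful"
proof -
  interpret linear_auction N M v V w f
  proof
    show "finite N" "finite M" "card M < card N"
      using \<open>m < n\<close> by (simp_all add: N_def M_def)
    show "V i {K} s = v i K (signals_for s K)" if "i \<in> N" "K \<in> M" for i K s
      using V_Max[of i "{K}" s] that by simp
  qed (fact w_linear f_linear w_mono V_empty v_eq deriv_less)+
  show ?thesis
    unfolding nash_equilibrium_def truthful_def
    \<comment> \<open>The deviating profile is \<open>s\<close> updated at \<open>i\<close>, so it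
      agrees with \<open>s\<close> at all other buyers.\<close>
    by (intro ballI allI truthful_optimal) auto
qed

end
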